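(* Consider the primal problem $$\min_{x\in\mathcal X} f(x)\quad\text{subject to } c_i(x)=0\ (i\in\mathcal E),\quad c_i(x)\ge 0\ (i\in\mathcal I),$$ with feasible set $\Omega$ and dual objective function $q$. For any feasible $x\in\Omega$, any $\lambda\in\mathbb R^{\mathcal E}$ and any $\mu\in\mathbb R^{\mathcal I}$ with $\mu\ge 0$, it holds that $q(\lambda,\mu)\le f(x)$. Equivalently, the infimum value of the primal problem is greater than or equal to the supremum value of the dual problem: $$\sup\{q(\lambda,\mu) : \lambda\in\mathbb R^{\mathcal E},\ \mu\in\mathbb R^{\mathcal I},\ \mu\ge 0,\ q(\lambda,\mu)\ne-\infty\}\ \le\ \inf_{x\in\Omega} f(x).$$
   Context: Setting: $\mathcal X\subseteq\mathbb R^n$ is a set, $\mathcal E$ and $\mathcal I$ are disjoint finite index sets, and $f:\mathbb R^n\to\mathbb R$ and $c_i:\mathbb R^n\to\mathbb R$ ($i\in\mathcal E\cup\mathcal I$) are real-valued functions. The feasible set is $\Omega=\{x\in\mathcal X : c_i(x)=0\ \forall i\in\mathcal E,\ c_i(x)\ge 0\ \forall i\in\mathcal I\}$. Lagrangian: $\mathcal L(x,\lambda,\mu)=f(x)-\sum_{i\in\mathcal E}\lambda_i c_i(x)-\sum_{i\in\mathcal I}\mu_i c_i(x)$. Dual objective: $q(\lambda,\mu)=\inf_{x\in\mathcal X}\mathcal L(x,\lambda,\mu)$, taken in the extended reals $[-\infty,+\infty]$. The dual problem is $\max_{\lambda,\mu} q(\lambda,\mu)$ subject to $\mu\ge 0$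 (componentwise), its domain being the set of all $(\lambda,\mu)$ with $q(\lambda,\mu)\ne-\infty$. Infima and suprema are taken in the extended reals, with $\inf\varnothing=+\infty$ and $\sup\varnothing=-\infty$. *)

theory Defs
  imports "HOL-Analysis.Analysis"
begin

text \<open>
  Equality and inequality constraints form one family \<open>c\<close>, indexed by the disjoint sets
  \<open>E\<close> and \<open>I\<close>. The multiplier space of real vectors indexed by \<open>E\<close> is \<open>E \<rightarrow>\<^sub>E UNIV\<close>,
  whose elements have exactly one value per index in \<open>E\<close> (and are \<open>undefined\<close> elsewhere).
\<close>

definition feasible_set ::
  "(real ^ 'n) set \<Rightarrow> 'i set \<Rightarrow> 'i set \<Rightarrow> ('i \<Rightarrow> real ^ 'n \<Rightarrow> real) \<Rightarrow> (real ^ 'n) set"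
  where "feasible_set X E I c = {x \<in> X. (\<forall>i\<in>E. c i x = 0) \<and> (\<forall>i\<in>I. c i x \<ge> 0)}"

definition lagrangian ::
  "'i set \<Rightarrow> 'i set \<Rightarrow> (real ^ 'n \<Rightarrow> real) \<Rightarrow> ('i \<Rightarrow> real ^ 'n \<Rightarrow> real) \<Rightarrow>
    real ^ 'n \<Rightarrow> ('i \<Rightarrow> real) \<Rightarrow> ('i \<Rightarrow> real) \<Rightarrow> real"
  where "lagrangian E I f c x lam mu = f x - (\<Sum>i\<in>E. lam i * c i x) - (\<Sum>i\<in>I. mu i * c i x)"

definition dual_objective ::
  "(real ^ 'n) set \<Rightarrow> 'i set \<Rightarrow> 'i set \<Rightarrow> (real ^ 'n \<Rightarrow> real) \<Rightarrow> ('i \<Rightarrow> real ^ 'n \<Rightarrow> real) \<Rightarrow>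
    ('i \<Rightarrow> real) \<Rightarrow> ('i \<Rightarrow> real) \<Rightarrow> ereal"
  where "dual_objective X E I f c lam mu = (INF x\<in>X. ereal (lagrangian E I f c x lam mu))"

end

theory Submission imports Defs begin

text \<open>
  Weak duality is a statement about signs. At a feasible point the equality terms of the
  Lagrangian vanish and the inequality terms, products of nonnegative multipliers with
  nonnegative constraint values, are only ever subtracted; so the Lagrangian lies below
  the objective there (\<open>lagrangian_le_objective\<close>). The dual objective is an infimum over all of
  \<open>X\<close>, which contains the feasible set, hence is smaller still (\<open>dual_objective_le_objective\<close>).
  Thus every dual value is a lower bound of every primal value, and passing to the supremum on
  one side and the infimum on the other preserves this. In the extended reals that last step
  includes the infeasible problem (infimum \<open>\<infinity>\<close>) and the dual with empty domain
  (supremum \<open>-\<infinity>\<close>).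
\<close>

lemma lagrangian_le_objective:
  assumes "x \<in> feasible_set X E I c" and "\<forall>i\<in>I. mu i \<ge> 0"
  shows "lagrangian E I f c x lam mu \<le> f x"
proof -
  have "(\<Sum>i\<in>E. lam i * c i x) = 0"
    using assms(1) by (simp add: feasible_set_def)
  moreover have "(\<Sum>i\<in>I. mu i * c i x) \<ge> 0"
    using assms by (simp add: feasible_set_def sum_nonneg)
  ultimately show ?thesis
    by (simp add: lagrangian_def)
qed

lemma dual_objective_le_objective:
  assumes "x \<in> feasible_set X E I c" and "\<forall>i\<in>I. mu i \<ge> 0"
  shows "dual_objective X E I f c lam mu \<le> ereal (f x)"
proof -
  have "x \<in> X"
    using assms(1) by (simp add: feasible_set_def)
  then have "dual_objective X E I f c lam mu \<le> ereal (lagrangian E I f c x lam mu)"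
    unfolding dual_objective_def by (rule INF_lower)
  also have "\<dots> \<le> ereal (f x)"
    using lagrangian_le_objective[OF assms] by simp
  finally show ?thesis .
qed

theorem theorem14:
  fixes X :: "(real ^ 'n) set"
    and E I :: "'i set"
    and f :: "real ^ 'n \<Rightarrow> real"
    and c :: "'i \<Rightarrow> real ^ 'n \<Rightarrow> real"
  assumes "finite E" and "finite I" and "E \<inter> I = {}"
  shows "(\<forall>x \<in> feasible_set X E I c. \<forall>lam \<in> E \<rightarrow>\<^sub>E UNIV. \<forall>mu \<in> I \<rightarrow>\<^sub>E UNIV.
            (\<forall>i\<in>I. mu i \<ge> 0) \<longrightarrow> dual_objective X E I f c lam mu \<le> ereal (f x)) \<and>
         Sup {dual_objective X E I f c lam mu | lam mu.
                lam \<in> E \<rightarrow>\<^sub>E UNIV \<and> mu \<in> I \<rightarrow>\<^sub>E UNIV \<and> (\<forall>i\<in>I. mu i \<ge> 0) \<and>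
                dual_objective X E I f c lam mu \<noteq> -\<infinity>}
           \<le> (INF x\<in>feasible_set X E I c. ereal (f x))"
proof
  show "\<forall>x \<in> feasible_set X E I c. \<forall>lam \<in> E \<rightarrow>\<^sub>E UNIV. \<forall>mu \<in> I \<rightarrow>\<^sub>E UNIV.
          (\<forall>i\<in>I. mu i \<ge> 0) \<longrightarrow> dual_objective X E I f c lam mu \<le> ereal (f x)"
    by (simp add: dual_objective_le_objective)
  show "Sup {dual_objective X E I f c lam mu | lam mu.
                lam \<in> E \<rightarrow>\<^sub>E UNIV \<and> mu \<in> I \<rightarrow>\<^sub>E UNIV \<and> (\<forall>i\<in>I. mu i \<ge> 0) \<and>
                dual_objective X E I f c lam mu \<noteq> -\<infinity>}
           \<le> (INF x\<in>feasible_set X E I c. ereal (f x))"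
    by (intro Sup_least INF_greatest) (auto intro: dual_objective_le_objective)
qed

end
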